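(* Let $s\ge2$, $h$, $t$ be positive integers with $t\mid h$ and $s<h$, and let $q=2^h$. Assume that $\mathbb{F}_q$ is the splitting field of $g(x)=x^{2^s+1}+ax^{2^s}+bx^{2^s-1}+c\in\mathbb{F}_{2^t}[x]$ with $b,c\ne0$, and that $\alpha_1,\dots,\alpha_{2^s+1}$ are all the roots of $g(x)$ and are pairwise distinct. Let $\eta_2\in\mathbb{F}_q^*$ and $\eta_1=\eta_2(b^{2^{h-1}}+a)$. Put $k=2^{s-1}$, and suppose that for every $k$-subset $I$ of $\{1,\dots,2^s+1\}$, writing $\prod_{i\in I}(x-\alpha_i)=c_0x^k+c_1x^{k-1}+\cdots+c_k$, one has $\eta_1c_1+\eta_2(c_2-c_1^2)\ne1$. Then there exists a $[2^s+1,\,2^{s-1},\,2^{s-1}+2]_q$ self-orthogonal MDS TGRS code, namely $\mathcal{C}_1=ev_{\boldsymbol{\alpha},\boldsymbol{v}}(\mathcal{S}_1)$, where $\boldsymbol{\alpha}=(\alpha_1,\dots,\alpha_{2^s+1})$, $\boldsymbol{v}=(v_1,\dots,v_{2^s+1})$ with $v_i=(\alpha_i^{2^{s-1}}+b^{2^{h-1}}\alpha_i^{2^{s-1}-1})^{-1}$, and $$\mathcal{S}_1=\Big\{\sum_{i=0}^{2^{s-1}-1}f_ix^i+f_{2^{s-1}-1}\big(\eta_1x^{2^{s-1}}+\eta_2x^{2^{s-1}+1}\big): f_i\in\mathbb{F}_q\text{ for }0\le i\le2^{s-1}-1\Big\}.$$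
   Context: For $\boldsymbol{\alpha}\in\mathbb{F}^n$ with distinct entries and $\boldsymbol{v}\in(\mathbb{F}^* )^n$ ($\mathbb{F}$ a finite field), $ev_{\boldsymbol{\alpha},\boldsymbol{v}}(f)=(v_1f(\alpha_1),\dots,v_nf(\alpha_n))$ for $f\in\mathbb{F}[x]$. For a $k\times(n-k)$ matrix $(\eta_{ij})$ over $\mathbb{F}$, the twisted generalized Reed-Solomon (TGRS) code is the image under $ev_{\boldsymbol{\alpha},\boldsymbol{v}}$ of $\{\sum_{i=0}^{k-1}f_ix^i+\sum_{i=0}^{k-1}f_i\sum_{j=1}^{n-k}\eta_{i+1,j}x^{k-1+j}:f_i\in\mathbb{F}\}$. An $[n,k,d]_q$ code is a linear code over $\mathbb{F}_q$ of length $n$, dimension $k$, minimum Hamming distance $d$; it is MDS if $d=n-k+1$. It is self-orthogonal if $\mathcal{C}\subseteq\mathcal{C}^\perp$ for the Euclidean inner product. *)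

theory Defs
  imports "HOL-Analysis.Analysis" "HOL-Computational_Algebra.Computational_Algebra"
begin

definition is_subfield :: "'a::field set \<Rightarrow> bool" where
  "is_subfield K \<longleftrightarrow> 0 \<in> K \<and> 1 \<in> K \<and>
     (\<forall>x\<in>K. \<forall>y\<in>K. x + y \<in> K \<and> x - y \<in> K \<and> x * y \<in> K) \<and>
     (\<forall>x\<in>K. inverse x \<in> K)"

text \<open>Minimality of the splitting field is stated within the ambient field: no proper
  subfield contains both \<open>K\<close> and the roots of \<open>g\<close>.\<close>

definition UNIV_splitting_field :: "'a::field set \<Rightarrow> 'a poly \<Rightarrow> bool" where
  "UNIV_splitting_field K g \<longleftrightarrow>
     is_subfield K \<and> set (coeffs g) \<subseteq> K \<and>
     (\<exists>rs. g = smult (lead_coeff g) (\<Prod>r\<leftarrow>rs. [:- r, 1:])) \<and>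
     (\<forall>L. is_subfield L \<and> K \<subseteq> L \<and> {x. poly g x = 0} \<subseteq> L \<longrightarrow> L = UNIV)"

definition hamming_dist :: "'a ^ 'n \<Rightarrow> 'a ^ 'n \<Rightarrow> nat" where
  "hamming_dist x y = card {i. x $ i \<noteq> y $ i}"

text \<open>Unspecified for codes with fewer than two words.\<close>

definition min_distance :: "('a ^ 'n) set \<Rightarrow> nat" where
  "min_distance C = Min {hamming_dist x y | x y. x \<in> C \<and> y \<in> C \<and> x \<noteq> y}"

text \<open>An $[n,k,d]_q$ code, where $q$ is the cardinality of the scalar field.\<close>

definition is_code :: "nat \<Rightarrow> nat \<Rightarrow> nat \<Rightarrow> nat \<Rightarrow> ('a::{field,finite} ^ 'n) set \<Rightarrow> bool" where
  "is_code n k d q C \<longleftrightarrow>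
     CARD('n) = n \<and> CARD('a) = q \<and> vec.subspace C \<and> vec.dim C = k \<and> min_distance C = d"

definition is_MDS :: "('a::{field,finite} ^ 'n) set \<Rightarrow> bool" where
  "is_MDS C \<longleftrightarrow> vec.subspace C \<and> min_distance C = CARD('n) - vec.dim C + 1"

definition dual_code :: "('a::{field,finite} ^ 'n) set \<Rightarrow> ('a ^ 'n) set" where
  "dual_code C = {y. \<forall>x\<in>C. (\<Sum>i\<in>UNIV. x $ i * y $ i) = 0}"

definition self_orthogonal :: "('a::{field,finite} ^ 'n) set \<Rightarrow> bool" where
  "self_orthogonal C \<longleftrightarrow> C \<subseteq> dual_code C"

definition ev :: "'a::{field,finite} ^ 'n \<Rightarrow> 'a ^ 'n \<Rightarrow> 'a poly \<Rightarrow> 'a ^ 'n" where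
  "ev \<alpha> v f = (\<chi> i. v $ i * poly f (\<alpha> $ i))"

text \<open>Only the entries \<open>\<eta> i j\<close> with \<open>1 \<le> i \<le> k\<close> and \<open>1 \<le> j \<le> n - k\<close> are used, so \<open>\<eta>\<close>
  represents a \<open>k \<times> (n - k)\<close> matrix.\<close>

definition twisted_polys :: "nat \<Rightarrow> nat \<Rightarrow> (nat \<Rightarrow> nat \<Rightarrow> 'a::field) \<Rightarrow> 'a poly set" where
  "twisted_polys n k \<eta> =
     {(\<Sum>i<k. monom (f i) i) +
      (\<Sum>i<k. smult (f i) (\<Sum>j=1..n-k. monom (\<eta> (i + 1) j) (k - 1 + j))) | f. True}"

definition is_TGRS_code ::
    "'a::{field,finite} ^ 'n \<Rightarrow> 'a ^ 'n \<Rightarrow> nat \<Rightarrow> ('a ^ 'n) set \<Rightarrow> bool" where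
  "is_TGRS_code \<alpha> v k C \<longleftrightarrow>
     k \<le> CARD('n) \<and> inj (\<lambda>i. \<alpha> $ i) \<and> (\<forall>i. v $ i \<noteq> 0) \<and>
     (\<exists>\<eta>. C = ev \<alpha> v ` twisted_polys CARD('n) k \<eta>)"

end

theory Submission
  imports Defs
begin

text \<open>Write \<open>n = 2k + 1\<close>. In characteristic two \<open>g' = x^(2k) + b x^(2k-2)\<close> is the square of
  \<open>x^k + \<beta> x^(k-1)\<close>, where \<open>\<beta>\<^sup>2 = b\<close>, so \<open>v\<^sub>i\<^sup>2 = 1 / g'(\<alpha>\<^sub>i)\<close> and the inner product of two codewords
  is \<open>L (p p')\<close> for \<open>L p = \<Sum>\<^sub>i p(\<alpha>\<^sub>i) / g'(\<alpha>\<^sub>i)\<close>. By Lagrange interpolation \<open>L\<close> is the coefficient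
  of \<open>x^(n-1)\<close> on polynomials of degree less than \<open>n\<close>, and reducing modulo \<open>g\<close> gives
  \<open>L (x^(n+1)) = a\<^sup>2 + b\<close>. Since cross terms of a square cancel, \<open>L (p p')\<close> is a multiple of
  \<open>\<eta>1\<^sup>2 + \<eta>2\<^sup>2 (a\<^sup>2 + b) = (\<eta>1 + \<eta>2 (a + \<beta>))\<^sup>2 = 0\<close>.

  For the distance, a nonzero message polynomial with \<open>k\<close> roots among the \<open>\<alpha>\<^sub>i\<close> must have degree
  \<open>k + 1\<close>; comparing its top three coefficients with those of \<open>(q\<^sub>0 + q\<^sub>1 x) \<Prod>\<^sub>i\<^sub>\<in>\<^sub>I (x - \<alpha>\<^sub>i)\<close> yields
  exactly the excluded equation.\<close>

section \<open>Interpolation\<close>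

lemma degree_prod_linear:
  "degree (\<Prod>x\<in>A. [:- f x, 1 :: 'a::idom:]) = card A"
  by (subst degree_prod_sum_eq) auto

lemma coeff_prod_linear_card:
  "coeff (\<Prod>x\<in>A. [:- f x, 1 :: 'a::idom:]) (card A) = 1"
  using lead_coeff_prod[of "\<lambda>x. [:- f x, 1:]" A] by (simp add: degree_prod_linear)

text \<open>The remainder modulo the product vanishes at \<open>card A\<close> distinct points but
  has smaller degree. The empty product is split off because there the strict degree bound would
  read \<open>0 < 0\<close>.\<close>

lemma prod_linear_dvd:
  fixes p :: "'a::field poly"
  assumes "finite A" "inj_on f A" "\<And>x. x \<in> A \<Longrightarrow> poly p (f x) = 0"
  shows "(\<Prod>x\<in>A. [:- f x, 1:]) dvd p"
proof -
  let ?P = "\<Prod>x\<in>A. [:- f x, 1:]"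
  have P: "?P \<noteq> 0" "degree ?P = card A"
    using assms(1) by (simp_all add: degree_prod_linear)
  show ?thesis
  proof (cases "A = {}")
    case False
    have "p mod ?P = 0"
    proof (rule poly_eqI_degree)
      fix z assume "z \<in> f ` A"
      then obtain x where x: "x \<in> A" "z = f x" by blast
      then have "poly ?P z = 0"
        using assms(1) by (auto simp: poly_prod)
      moreover have "poly p z = poly (p div ?P) z * poly ?P z + poly (p mod ?P) z"
        by (metis div_mult_mod_eq poly_add poly_mult)
      ultimately show "poly (p mod ?P) z = poly 0 z"
        using x assms(3) by simp
    next
      show "degree (p mod ?P) < card (f ` A)"
        using degree_mod_less[of ?P p] P False assms(1,2) by (auto simp: card_image card_gt_0_iff)
      show "degree (0 :: 'a poly) < card (f ` A)"
        using False assms(1,2) by (simp add: card_image card_gt_0_iff)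
    qed
    then show ?thesis by (simp add: dvd_eq_mod_eq_0)
  qed simp
qed

text \<open>In the product rule, every summand except the one omitting the factor of
  \<open>x\<close> still contains that factor and vanishes at \<open>x\<close>.\<close>

lemma poly_pderiv_prod_linear:
  fixes x :: "'a::idom"
  assumes "finite A" "x \<in> A"
  shows "poly (pderiv (\<Prod>y\<in>A. [:- y, 1:])) x = poly (\<Prod>y\<in>A - {x}. [:- y, 1:]) x"
proof -
  have "poly (pderiv (\<Prod>y\<in>A. [:- y, 1:])) x = (\<Sum>y\<in>A. poly (\<Prod>z\<in>A - {y}. [:- z, 1:]) x)"
    by (simp add: pderiv_prod poly_sum pderiv_pCons)
  also have "\<dots> = (\<Sum>y\<in>{x}. poly (\<Prod>z\<in>A - {y}. [:- z, 1:]) x)"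
    using assms by (intro sum.mono_neutral_right) (auto simp: poly_prod)
  finally show ?thesis by simp
qed

text \<open>By Lagrange interpolation, \<open>p\<close> is a combination of the products
  \<open>L x\<close> that omit one factor, with weights p(x)/g'(x). Each \<open>L x\<close> is monic
  of degree \<open>card A - 1\<close>, so the coefficient of \<open>p\<close> in that degree is the
  sum of the weights.\<close>

lemma sum_poly_div_pderiv:
  fixes p :: "'a::field poly"
  assumes fin: "finite A" and deg: "degree p < card A"
  defines "g \<equiv> \<Prod>x\<in>A. [:- x, 1:]"
  shows "(\<Sum>x\<in>A. poly p x / poly (pderiv g) x) = coeff p (card A - 1)"
proof -
  define L where "L x = (\<Prod>y\<in>A - {x}. [:- y, 1:])" for x
  define w where "w x = poly p x / poly (pderiv g) x" for x
  have deriv: "poly (pderiv g) x = poly (L x) x" if "x \<in> A" for x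
    using poly_pderiv_prod_linear[OF fin that] by (simp add: g_def L_def)
  have nz: "poly (L x) x \<noteq> 0" for x
    using fin by (auto simp: L_def poly_prod)
  have "p = (\<Sum>x\<in>A. smult (w x) (L x))"
  proof (rule poly_eqI_degree)
    fix z assume z: "z \<in> A"
    have "poly (\<Sum>x\<in>A. smult (w x) (L x)) z = (\<Sum>x\<in>{z}. w x * poly (L x) z)"
      unfolding poly_sum poly_smult
      using fin z by (intro sum.mono_neutral_right) (auto simp: L_def poly_prod)
    then show "poly p z = poly (\<Sum>x\<in>A. smult (w x) (L x)) z"
      using nz[of z] z by (simp add: w_def deriv)
  next
    show "degree p < card A" by fact
    have "degree (smult (w x) (L x)) \<le> card A - 1" if "x \<in> A" for x
      using that fin degree_smult_le[of "w x" "L x"] by (simp add: L_def degree_prod_linear)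
    then have "degree (\<Sum>x\<in>A. smult (w x) (L x)) \<le> card A - 1"
      by (intro degree_sum_le fin)
    then show "degree (\<Sum>x\<in>A. smult (w x) (L x)) < card A"
      using deg by linarith
  qed
  then have "coeff p (card A - 1) = coeff (\<Sum>x\<in>A. smult (w x) (L x)) (card A - 1)"
    by (rule arg_cong)
  also have "\<dots> = (\<Sum>x\<in>A. w x * coeff (L x) (card A - 1))"
    by (simp add: coeff_sum)
  also have "\<dots> = (\<Sum>x\<in>A. w x)"
  proof (rule sum.cong)
    fix x assume "x \<in> A"
    then have "card (A - {x}) = card A - 1"
      using fin by simp
    then show "w x * coeff (L x) (card A - 1) = w x"
      using coeff_prod_linear_card[of "\<lambda>x. x" "A - {x}"] by (simp add: L_def)
  qed simp
  finally show ?thesis by (simp add: w_def)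
qed

section \<open>Linear codes\<close>

lemma hamming_dist_eq_weight:
  fixes x y :: "'a::ab_group_add ^ 'n"
  shows "hamming_dist x y = hamming_dist (x - y) 0"
  by (simp add: hamming_dist_def)

lemma min_distance_eqI:
  fixes C :: "('a::{field,finite} ^ 'n) set"
  assumes sub: "vec.subspace C"
    and x: "x \<in> C" "x \<noteq> 0" "hamming_dist x 0 = d"
    and min: "\<And>y. y \<in> C \<Longrightarrow> y \<noteq> 0 \<Longrightarrow> d \<le> hamming_dist y 0"
  shows "min_distance C = d"
  unfolding min_distance_def
proof (rule Min_eqI)
  let ?D = "{hamming_dist x y | x y. x \<in> C \<and> y \<in> C \<and> x \<noteq> y}"
  have "?D \<subseteq> range (\<lambda>(x :: 'a ^ 'n, y). hamming_dist x y)"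
    by auto
  then show "finite ?D"
    by (rule finite_subset) simp
  show "d \<in> ?D"
    using x vec.subspace_0[OF sub] by blast
  fix e assume "e \<in> ?D"
  then obtain x y where "e = hamming_dist x y" "x \<in> C" "y \<in> C" "x \<noteq> y"
    by blast
  then show "d \<le> e"
    using min[of "x - y"] vec.subspace_diff[OF sub] hamming_dist_eq_weight[of x y] by simp
qed

text \<open>Passes from independence of an indexed family to the set-based notions of span and
  dimension, which requires \<open>w\<close> to be injective on the indices below
  \<open>k\<close>.\<close>

lemma dim_range_combinations:
  fixes w :: "nat \<Rightarrow> 'a::field ^ 'n"
  assumes indep: "\<And>f i. (\<Sum>i<k. f i *s w i) = 0 \<Longrightarrow> i < k \<Longrightarrow> f i = 0"
  shows "vec.subspace (range (\<lambda>f. \<Sum>i<k. f i *s w i))"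
    and "vec.dim (range (\<lambda>f. \<Sum>i<k. f i *s w i)) = k"
proof -
  let ?C = "range (\<lambda>f. \<Sum>i<k. f i *s w i)"
  have inj: "inj_on w {..<k}"
  proof (rule inj_onI, rule ccontr)
    fix i j assume ij: "i \<in> {..<k}" "j \<in> {..<k}" "w i = w j" "i \<noteq> j"
    \<comment> \<open>If \<open>w i = w j\<close>, the coefficients 1 at \<open>i\<close> and -1 at
      \<open>j\<close> form a nontrivial relation.\<close>
    have "(\<Sum>l<k. (of_bool (l = i) - of_bool (l = j)) *s w l)
        = (\<Sum>l<k. (if l = i then w l else 0)) - (\<Sum>l<k. (if l = j then w l else 0))"
      unfolding sum_subtractf[symmetric] by (rule sum.cong) auto
    also have "\<dots> = 0"
      using ij by simp
    finally have "of_bool (i = i) - of_bool (i = j) = (0 :: 'a)"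
      by (rule indep) (use ij in simp)
    with ij show False by simp
  qed
  have span: "vec.span (w ` {..<k}) = ?C"
  proof -
    have "vec.span (w ` {..<k}) = range (\<lambda>u. \<Sum>i<k. u (w i) *s w i)"
      by (simp add: vec.span_finite sum.reindex[OF inj])
    moreover have "(\<Sum>i<k. f i *s w i) = (\<Sum>i<k. (f \<circ> inv_into {..<k} w) (w i) *s w i)" for f
      using inj by (intro sum.cong) auto
    then have "?C \<subseteq> range (\<lambda>u. \<Sum>i<k. u (w i) *s w i)"
      by (blast intro: range_eqI)
    ultimately show ?thesis
      by auto
  qed
  have "vec.independent (w ` {..<k})"
  proof (rule vec.independent_if_scalars_zero)
    fix f x assume "(\<Sum>x\<in>w ` {..<k}. f x *s x) = 0" "x \<in> w ` {..<k}"
    then show "f x = 0"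
      using indep[of "f \<circ> w"] by (auto simp: sum.reindex[OF inj])
  qed simp
  then show "vec.dim ?C = k"
    using vec.dim_span_eq_card_independent[of "w ` {..<k}"] card_image[OF inj] span by simp
  show "vec.subspace ?C"
    using vec.subspace_span[of "w ` {..<k}"] span by simp
qed

lemma ev_eq_0_iff:
  fixes \<alpha> v :: "'a::{field,finite} ^ 'n"
  assumes "\<And>i. v $ i \<noteq> 0"
  shows "ev \<alpha> v f = 0 \<longleftrightarrow> (\<forall>i. poly f (\<alpha> $ i) = 0)"
  using assms by (simp add: ev_def vec_eq_iff)

lemma weight_ev:
  fixes \<alpha> v :: "'a::{field,finite} ^ 'n"
  assumes "\<And>i. v $ i \<noteq> 0"
  shows "hamming_dist (ev \<alpha> v f) 0 = CARD('n) - card {i. poly f (\<alpha> $ i) = 0}"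
proof -
  have "{i. ev \<alpha> v f $ i \<noteq> 0 $ i} = UNIV - {i. poly f (\<alpha> $ i) = 0}"
    using assms by (auto simp: ev_def)
  then show ?thesis
    by (simp add: hamming_dist_def card_Diff_subset)
qed

section \<open>Two twists on the leading message symbol\<close>

text \<open>A total function encodes the message. For \<open>k > 0\<close> only its first
  \<open>k\<close> values matter, so the message polynomials are simply the range of this
  map.\<close>

definition two_twist :: "nat \<Rightarrow> 'a::field \<Rightarrow> 'a \<Rightarrow> (nat \<Rightarrow> 'a) \<Rightarrow> 'a poly" where
  "two_twist k \<eta>1 \<eta>2 f =
     (\<Sum>i<k. monom (f i) i) + smult (f (k - 1)) (monom \<eta>1 k + monom \<eta>2 (k + 1))"

lemma coeff_two_twist:
  "coeff (two_twist k \<eta>1 \<eta>2 f) j =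
     (if j < k then f j else if j = k then \<eta>1 * f (k - 1)
      else if j = k + 1 then \<eta>2 * f (k - 1) else 0)"
  by (auto simp: two_twist_def coeff_sum)

lemma degree_two_twist_le: "degree (two_twist k \<eta>1 \<eta>2 f) \<le> k + 1"
  by (rule degree_le) (simp add: coeff_two_twist)

text \<open>Separates the free part, of degree below \<open>k - 1\<close>, from the one generator
  that carries the twists.\<close>

lemma two_twist_split:
  assumes "k > 0"
  shows "two_twist k \<eta>1 \<eta>2 f = (\<Sum>i<k - 1. monom (f i) i) +
           smult (f (k - 1)) (monom 1 (k - 1) + monom \<eta>1 k + monom \<eta>2 (k + 1))"
  using assms by (cases k) (simp_all add: two_twist_def smult_add_right smult_monom)

text \<open>The polynomial depends linearly on the message, so the unit messages yield generators of
  the code.\<close>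

lemma two_twist_eq_sum:
  assumes "k > 0"
  shows "two_twist k \<eta>1 \<eta>2 f = (\<Sum>i<k. smult (f i) (two_twist k \<eta>1 \<eta>2 (\<lambda>j. of_bool (j = i))))"
proof (rule poly_eqI)
  fix j
  have sel: "(\<Sum>i<k. f i * (c * of_bool (l = i))) = (if l < k then c * f l else 0)" for l c
    by (simp add: of_bool_def if_distrib sum.delta cong: if_cong)
  have sel1: "(\<Sum>i<k. f i * of_bool (l = i)) = (if l < k then f l else 0)" for l
    using sel[of 1 l] by simp
  show "coeff (two_twist k \<eta>1 \<eta>2 f) j =
      coeff (\<Sum>i<k. smult (f i) (two_twist k \<eta>1 \<eta>2 (\<lambda>j. of_bool (j = i)))) j"
    using assms sel1[of j] sel[of _ "k - 1"] unfolding coeff_sum coeff_smult coeff_two_twist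
    by auto
qed

lemma ev_two_twist:
  assumes "k > 0"
  shows "ev \<alpha> v (two_twist k \<eta>1 \<eta>2 f) =
    (\<Sum>i<k. f i *s ev \<alpha> v (two_twist k \<eta>1 \<eta>2 (\<lambda>j. of_bool (j = i))))"
  unfolding two_twist_eq_sum[OF assms, of _ _ f]
  by (simp add: ev_def vec_eq_iff poly_sum sum_distrib_left algebra_simps)

lemma card_roots_two_twist_less:
  fixes \<alpha> :: "'n::finite \<Rightarrow> 'a::field"
  assumes k: "k \<ge> 2" and inj: "inj \<alpha>" and \<eta>2: "\<eta>2 \<noteq> 0"
    and twist: "\<And>I (d :: nat \<Rightarrow> 'a). card I = k \<Longrightarrow>
           (\<Prod>i\<in>I. [:- \<alpha> i, 1:]) = (\<Sum>j\<le>k. monom (d j) (k - j)) \<Longrightarrow>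
           \<eta>1 * d 1 + \<eta>2 * (d 2 - (d 1)\<^sup>2) \<noteq> 1"
    and nz: "two_twist k \<eta>1 \<eta>2 f \<noteq> 0"
  shows "card {i. poly (two_twist k \<eta>1 \<eta>2 f) (\<alpha> i) = 0} < k"
proof (rule ccontr)
  define p where "p = two_twist k \<eta>1 \<eta>2 f"
  assume "\<not> ?thesis"
  then obtain I where I: "I \<subseteq> {i. poly p (\<alpha> i) = 0}" "card I = k"
    unfolding p_def by (metis not_less obtain_subset_with_card_n)
  define P where "P = (\<Prod>i\<in>I. [:- \<alpha> i, 1:])"
  have degP: "degree P = k" and leadP: "coeff P k = 1"
    using degree_prod_linear[of \<alpha> I] coeff_prod_linear_card[of \<alpha> I] I by (simp_all add: P_def)
  have "P dvd p"
    unfolding P_def using I inj by (intro prod_linear_dvd) (auto intro: inj_on_subset)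
  then obtain Q where Q: "p = P * Q" ..
  have "P \<noteq> 0" "Q \<noteq> 0"
    using nz Q by (auto simp: p_def)
  then have "degree p = k + degree Q"
    using Q degP by (simp add: degree_mult_eq)
  then have "degree Q \<le> 1"
    using degree_two_twist_le[of k \<eta>1 \<eta>2 f] by (simp add: p_def)
  then obtain q0 q1 where "Q = [:q0, q1:]"
    using that[of "coeff Q 0" "coeff Q 1"]
    by (auto simp: poly_eq_iff coeff_pCons coeff_eq_0 split: nat.splits)
  then have p: "p = smult q0 P + pCons 0 (smult q1 P)"
    using Q by (simp add: mult.commute)
  define F where "F = f (k - 1)"
  obtain m where m: "k = Suc (Suc m)"
    using k by (metis add_2_eq_Suc le_Suc_ex)
  have "coeff p (Suc k) = q1" "coeff p k = q0 + q1 * coeff P (k - 1)"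
    "coeff p (k - 1) = q0 * coeff P (k - 1) + q1 * coeff P (k - 2)"
    using leadP degP unfolding p by (simp_all add: m coeff_eq_0)
  \<comment> \<open>Both descriptions of \<open>p\<close> are compared in degrees
    \<open>k + 1\<close>, \<open>k\<close> and \<open>k - 1\<close>. Eliminating \<open>q0\<close>
    and \<open>q1\<close> from the three equations leaves \<open>F\<close> times the excluded
    relation.\<close>
  then have eqs: "q1 = \<eta>2 * F" "q0 + q1 * coeff P (k - 1) = \<eta>1 * F"
    "q0 * coeff P (k - 1) + q1 * coeff P (k - 2) = F"
    using k by (simp_all add: p_def coeff_two_twist F_def)
  \<comment> \<open>If \<open>F\<close> were zero, the first two equations would give
    \<open>q1 = 0\<close> and then \<open>q0 = 0\<close>, against \<open>Q\<close> being
    nonzero.\<close>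
  have "F \<noteq> 0"
    using eqs \<open>Q \<noteq> 0\<close> \<open>Q = [:q0, q1:]\<close> by auto
  have "F * (\<eta>1 * coeff P (k - 1) + \<eta>2 * (coeff P (k - 2) - (coeff P (k - 1))\<^sup>2)) = F * 1"
    using eqs by (algebra)
  then have "\<eta>1 * coeff P (k - 1) + \<eta>2 * (coeff P (k - 2) - (coeff P (k - 1))\<^sup>2) = 1"
    using \<open>F \<noteq> 0\<close> by simp
  moreover have "P = (\<Sum>j\<le>k. monom (coeff P (k - j)) (k - j))"
  proof -
    have "P = (\<Sum>j\<le>k. monom (coeff P j) j)"
      using poly_as_sum_of_monoms[of P] degP by simp
    also have "\<dots> = (\<Sum>j\<le>k. monom (coeff P (k - j)) (k - j))"
      by (rule sum.reindex_bij_witness[of _ "\<lambda>j. k - j" "\<lambda>j. k - j"]) auto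
    finally show ?thesis .
  qed
  ultimately show False
    using twist[OF I(2), of "\<lambda>j. coeff P (k - j)"] by (simp add: P_def)
qed

text \<open>Supplies a word of least weight. The twisted generator minus its remainder modulo the
  product \<open>P\<close> over \<open>I\<close> is divisible by \<open>P\<close>; as
  \<open>P\<close> has degree \<open>k - 1\<close>, the remainder only alters free coefficients and
  the twisted shape survives.\<close>

lemma two_twist_vanishing_on:
  fixes \<alpha> :: "'n::finite \<Rightarrow> 'a::field"
  assumes k: "k > 0" and I: "card I = k - 1"
  obtains f where "f (k - 1) = 1" "\<And>i. i \<in> I \<Longrightarrow> poly (two_twist k \<eta>1 \<eta>2 f) (\<alpha> i) = 0"
proof -
  define P where "P = (\<Prod>i\<in>I. [:- \<alpha> i, 1:])"
  define p where "p = monom 1 (k - 1) + monom \<eta>1 k + monom \<eta>2 (k + 1)"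
  define f where "f j = coeff (p - p mod P) j" for j
  have "degree P = k - 1"
    using degree_prod_linear[of \<alpha> I] I by (simp add: P_def)
  moreover have "P \<noteq> 0"
    by (simp add: P_def)
  ultimately have small: "coeff (p mod P) j = 0" if "j \<ge> k - 1" for j
    using that degree_mod_less[of P p] by (metis coeff_0 coeff_eq_0 order_less_le_trans)
  have coeff_p: "coeff p j =
      (if j = k - 1 then 1 else if j = k then \<eta>1 else if j = k + 1 then \<eta>2 else 0)" for j
    using k by (auto simp: p_def)
  have "two_twist k \<eta>1 \<eta>2 f = p - p mod P"
    using k by (intro poly_eqI) (auto simp: coeff_two_twist f_def small coeff_p)
  also have "\<dots> = P * (p div P)"
    by (simp add: minus_mod_eq_mult_div)
  finally have "poly (two_twist k \<eta>1 \<eta>2 f) (\<alpha> i) = 0" if "i \<in> I" for i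
    using that by (auto simp: P_def poly_prod)
  moreover have "f (k - 1) = 1"
    using k by (simp add: f_def small coeff_p)
  ultimately show thesis
    using that by blast
qed

text \<open>Fewer than \<open>k\<close> roots per nonzero polynomial gives both injectivity of the
  encoding, hence the dimension, and the lower bound on weights. A word vanishing at
  \<open>k - 1\<close> positions attains the bound.\<close>

lemma two_twist_code_parameters:
  fixes \<alpha> v :: "'a::{field,finite} ^ 'n"
  assumes k: "k \<ge> 2" "k \<le> CARD('n)"
    and inj: "inj (\<lambda>i. \<alpha> $ i)" and \<eta>2: "\<eta>2 \<noteq> 0" and v: "\<And>i. v $ i \<noteq> 0"
    and twist: "\<And>I (d :: nat \<Rightarrow> 'a). card I = k \<Longrightarrow>
           (\<Prod>i\<in>I. [:- (\<alpha> $ i), 1:]) = (\<Sum>j\<le>k. monom (d j) (k - j)) \<Longrightarrow>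
           \<eta>1 * d 1 + \<eta>2 * (d 2 - (d 1)\<^sup>2) \<noteq> 1"
  defines "C \<equiv> ev \<alpha> v ` range (two_twist k \<eta>1 \<eta>2)"
  shows "vec.subspace C" "vec.dim C = k" "min_distance C = CARD('n) - k + 1"
proof -
  let ?Z = "\<lambda>f. {i. poly (two_twist k \<eta>1 \<eta>2 f) (\<alpha> $ i) = 0}"
  have less: "card (?Z f) < k" if "two_twist k \<eta>1 \<eta>2 f \<noteq> 0" for f
    using card_roots_two_twist_less[OF k(1) inj \<eta>2 twist that] .
  \<comment> \<open>A zero word would come from a polynomial with all \<open>CARD('n)\<close>
    positions as roots, and that number is at least \<open>k\<close>.\<close>
  have zero: "two_twist k \<eta>1 \<eta>2 f = 0" if "ev \<alpha> v (two_twist k \<eta>1 \<eta>2 f) = 0" for f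
    using less[of f] k that ev_eq_0_iff[OF v, of \<alpha>] by fastforce
  define w where "w i = ev \<alpha> v (two_twist k \<eta>1 \<eta>2 (\<lambda>j. of_bool (j = i)))" for i
  have w: "ev \<alpha> v (two_twist k \<eta>1 \<eta>2 f) = (\<Sum>i<k. f i *s w i)" for f
    using ev_two_twist[of k] k by (simp add: w_def)
  have C: "C = range (\<lambda>f. \<Sum>i<k. f i *s w i)"
    unfolding C_def image_image w ..
  have indep: "f i = 0" if "(\<Sum>i<k. f i *s w i) = 0" "i < k" for f i
    using zero[of f] that coeff_two_twist[of k \<eta>1 \<eta>2 f i] w[of f] by simp
  show sub: "vec.subspace C" and "vec.dim C = k"
    unfolding C using dim_range_combinations[where w = w and k = k] indep by blast+
  obtain I :: "'n set" where I: "card I = k - 1"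
    using k by (meson diff_le_self le_trans obtain_subset_with_card_n)
  have "k > 0"
    using k by simp
  obtain f where "f (k - 1) = 1" "\<And>i. i \<in> I \<Longrightarrow> poly (two_twist k \<eta>1 \<eta>2 f) (\<alpha> $ i) = 0"
    using two_twist_vanishing_on[OF \<open>k > 0\<close> I] by blast
  then have f: "f (k - 1) = 1" "I \<subseteq> ?Z f"
    by auto
  have nz: "two_twist k \<eta>1 \<eta>2 f \<noteq> 0"
    using f(1) k coeff_two_twist[of k \<eta>1 \<eta>2 f "k - 1"] by auto
  have "card (?Z f) = k - 1"
    using less[OF nz] card_mono[OF _ f(2)] I by simp
  show "min_distance C = CARD('n) - k + 1"
  proof (rule min_distance_eqI[OF sub])
    show "ev \<alpha> v (two_twist k \<eta>1 \<eta>2 f) \<in> C"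
      by (simp add: C_def)
    show "ev \<alpha> v (two_twist k \<eta>1 \<eta>2 f) \<noteq> 0"
      using zero nz by blast
    show "hamming_dist (ev \<alpha> v (two_twist k \<eta>1 \<eta>2 f)) 0 = CARD('n) - k + 1"
      using \<open>card (?Z f) = k - 1\<close> k by (simp add: weight_ev[OF v])
  next
    fix y assume y: "y \<in> C" "y \<noteq> 0"
    then obtain f where "y = ev \<alpha> v (two_twist k \<eta>1 \<eta>2 f)"
      by (auto simp: C_def)
    moreover from this y have "two_twist k \<eta>1 \<eta>2 f \<noteq> 0"
      by (auto simp: ev_eq_0_iff[OF v])
    ultimately show "CARD('n) - k + 1 \<le> hamming_dist y 0"
      using less[of f] k by (simp add: weight_ev[OF v])
  qed
qed

text \<open>The matrix is zero outside its last row, which begins with \<open>\<eta>1\<close>,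
  \<open>\<eta>2\<close>. Rows count from 1, so row \<open>k\<close> belongs to message index
  \<open>k - 1\<close>; \<open>k + 2 \<le> n\<close> provides the two columns.\<close>

lemma range_two_twist_eq_twisted_polys:
  assumes "k > 0" "k + 2 \<le> n"
  shows "range (two_twist k \<eta>1 \<eta>2) = twisted_polys n k
    (\<lambda>i j. if i = k then if j = 1 then \<eta>1 else if j = 2 then \<eta>2 else 0 else 0)"
    (is "_ = twisted_polys n k ?\<eta>")
proof -
  have "(\<Sum>j=1..n-k. monom (?\<eta> (i + 1) j) (k - 1 + j)) =
      (if i = k - 1 then monom \<eta>1 k + monom \<eta>2 (k + 1) else 0)" if "i < k" for i
  proof (cases "i = k - 1")
    case True
    have "(\<Sum>j=1..n-k. monom (?\<eta> (i + 1) j) (k - 1 + j))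
        = (\<Sum>j\<in>{1, 2}. monom (?\<eta> (i + 1) j) (k - 1 + j))"
      using assms by (intro sum.mono_neutral_right) auto
    then show ?thesis
      using True assms by simp
  next
    case False
    then have "i + 1 \<noteq> k"
      using that by linarith
    then show ?thesis
      using False by simp
  qed
  then have "(\<Sum>i<k. smult (f i) (\<Sum>j=1..n-k. monom (?\<eta> (i + 1) j) (k - 1 + j)))
      = (\<Sum>i<k. if i = k - 1 then smult (f i) (monom \<eta>1 k + monom \<eta>2 (k + 1)) else 0)" for f
    by (intro sum.cong) auto
  then have "(\<Sum>i<k. smult (f i) (\<Sum>j=1..n-k. monom (?\<eta> (i + 1) j) (k - 1 + j)))
      = smult (f (k - 1)) (monom \<eta>1 k + monom \<eta>2 (k + 1))" for f
    using assms by simp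
  then show ?thesis
    unfolding twisted_polys_def two_twist_def by auto
qed

section \<open>Self-orthogonality in characteristic two\<close>

text \<open>Multiplication by a nonzero \<open>x\<close> permutes the nonzero elements; comparing
  their products before and after gives x^(q-1) = 1.\<close>

lemma finite_field_power_card:
  fixes x :: "'a::{field,finite}"
  shows "x ^ CARD('a) = x"
proof (cases "x = 0")
  case False
  let ?U = "UNIV - {0 :: 'a}"
  have "bij_betw ((*) x) ?U ?U"
    using False by (intro bij_betwI[of _ _ _ "\<lambda>y. y / x"]) auto
  then have "(\<Prod>y\<in>?U. y) = (\<Prod>y\<in>?U. x * y)"
    using prod.reindex_bij_betw[of "(*) x" ?U ?U "\<lambda>y. y"] by simp
  then have "x ^ card ?U = 1"
    by (simp add: prod.distrib)
  moreover have "CARD('a) = Suc (card ?U)"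
    by (simp add: card_Suc_Diff1)
  ultimately show ?thesis by (simp only: power_Suc mult_1_right)
qed (simp add: zero_power)

text \<open>Raising -1 to the even power \<open>CARD('a)\<close> gives 1, yet that power fixes every
  element, so -1 = 1.\<close>

lemma two_eq_0_if_even_card:
  assumes "even (CARD('a::{field,finite}))"
  shows "(2 :: 'a) = 0"
proof -
  have "(- 1 :: 'a) = (- 1) ^ CARD('a)"
    using finite_field_power_card[of "- 1 :: 'a"] by simp
  also have "\<dots> = 1"
    using assms by simp
  finally have "1 + (1 :: 'a) = 0"
    by (metis add.right_inverse)
  then show ?thesis by simp
qed

lemma pderiv_char_2:
  fixes a b c :: "'a::field"
  assumes two: "(2 :: 'a) = 0" and k: "k > 0"
  shows "pderiv (monom 1 (2 * k + 1) + monom a (2 * k) + monom b (2 * k - 1) + [:c:])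
    = monom 1 (2 * k) + monom b (2 * k - 2)"
proof -
  obtain m where m: "k = Suc m"
    using k by (cases k) auto
  have "of_nat (2 * n) = (0 :: 'a)" for n
    using two by simp
  then show ?thesis
    using two by (simp add: m pderiv_add pderiv_monom pderiv_pCons)
qed

text \<open>Each factor is \<open>u f\<close> plus a multiple of \<open>T\<close>. Products
  involving some \<open>u f\<close> have degree at most (k - 2) + (k + 1) = 2k - 1, or vanish, so
  \<open>L\<close> kills them; only \<open>L (T * T)\<close> remains.\<close>

lemma two_twist_orthogonal:
  fixes a b c \<beta> \<eta>2 :: "'a::field" and A :: "'a set"
  assumes two: "(2 :: 'a) = 0" and k: "k \<ge> 1" and \<beta>: "\<beta>\<^sup>2 = b"
    and A: "finite A" "card A = 2 * k + 1"
    and g: "(\<Prod>x\<in>A. [:- x, 1:]) = monom 1 (2 * k + 1) + monom a (2 * k) + monom b (2 * k - 1) + [:c:]"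
    and \<eta>1: "\<eta>1 = \<eta>2 * (\<beta> + a)"
  shows "(\<Sum>x\<in>A. poly (two_twist k \<eta>1 \<eta>2 f * two_twist k \<eta>1 \<eta>2 f') x
            / poly (pderiv (\<Prod>x\<in>A. [:- x, 1:])) x) = 0"
proof -
  have neg: "- z = z" for z :: 'a
    using two by (metis add_eq_0_iff2 mult_2 mult_zero_left)
  define L where "L p = (\<Sum>x\<in>A. poly p x / poly (pderiv (\<Prod>x\<in>A. [:- x, 1:])) x)" for p
  have L_add: "L (p + r) = L p + L r" for p r
    by (simp add: L_def add_divide_distrib sum.distrib)
  have L_smult: "L (smult z p) = z * L p" for z p
    by (simp add: L_def sum_distrib_left)
  have L_coeff: "L p = coeff p (2 * k)" if "degree p \<le> 2 * k" for p
    using sum_poly_div_pderiv[OF A(1), of p] that A(2) by (simp add: L_def)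
  \<comment> \<open>Every \<open>x\<close> in \<open>A\<close> is a root of the product, so its top
    power can be rewritten; signs disappear because -1 = 1.\<close>
  have red: "L (monom 1 (2 * k + 1 + j)) =
      a * L (monom 1 (2 * k + j)) + b * L (monom 1 (2 * k - 1 + j)) + c * L (monom 1 j)" for j
  proof -
    have "x ^ (2 * k + 1 + j) = a * x ^ (2 * k + j) + b * x ^ (2 * k - 1 + j) + c * x ^ j"
      if "x \<in> A" for x
    proof -
      have "poly (\<Prod>x\<in>A. [:- x, 1:]) x = 0"
        using A that by (auto simp: poly_prod)
      then have "x ^ (2 * k + 1) + a * x ^ (2 * k) + b * x ^ (2 * k - 1) + c = 0"
        unfolding g by (simp add: poly_monom)
      then have "x ^ (2 * k + 1) = - (a * x ^ (2 * k) + b * x ^ (2 * k - 1) + c)"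
        by (simp only: eq_neg_iff_add_eq_0 add.assoc)
      then have "x ^ (2 * k + 1) = a * x ^ (2 * k) + b * x ^ (2 * k - 1) + c"
        by (simp only: neg)
      then show ?thesis
        unfolding power_add[of x _ j] by (simp only: distrib_right mult.assoc)
    qed
    then show ?thesis
      unfolding L_def poly_monom
      by (simp add: sum_distrib_left sum.distrib[symmetric] add_divide_distrib cong: sum.cong)
  qed
  have mon: "L (monom 1 j) = of_bool (j = 2 * k)" if "j \<le> 2 * k" for j
    using that by (subst L_coeff) (auto simp: degree_monom_eq)
  have "L (monom 1 (2 * k + 1)) = a"
    using red[of 0] mon[of "2 * k"] mon[of "2 * k - 1"] mon[of 0] k by auto
  \<comment> \<open>Reducing once more gives a L(x^(2k+1)) + b L(x^(2k)) + c L(x), where the last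
    value is 0 because 1 < 2k.\<close>
  then have top: "L (monom 1 (2 * k + 2)) = a\<^sup>2 + b"
    using red[of 1] mon[of "2 * k"] mon[of 1] k by (simp add: power2_eq_square)
  define T where "T = monom 1 (k - 1) + monom \<eta>1 k + monom \<eta>2 (k + 1)"
  have "T * T = monom 1 (2 * k - 2) + monom (\<eta>1\<^sup>2) (2 * k) + monom (\<eta>2\<^sup>2) (2 * k + 2)"
  proof -
    have "(2 :: 'a poly) = 0"
      using two by (simp add: numeral_poly)
    moreover obtain m where "k = Suc m"
      using k by (cases k) auto
    ultimately show ?thesis
      by (simp add: T_def algebra_simps mult_monom power2_eq_square mult_2_right)
  qed
  then have "L (T * T) = \<eta>1\<^sup>2 + \<eta>2\<^sup>2 * (a\<^sup>2 + b)"
    using top mon[of "2 * k"] mon[of "2 * k - 2"] k L_smult[of "\<eta>1\<^sup>2" "monom 1 (2 * k)"]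
      L_smult[of "\<eta>2\<^sup>2" "monom 1 (2 * k + 2)"] by (simp add: L_add smult_monom)
  \<comment> \<open>Inserting \<open>\<eta>1\<close> and b = \<beta>^2 makes every term occur with
    an even coefficient.\<close>
  also have "\<dots> = 2 * \<eta>2\<^sup>2 * (\<beta>\<^sup>2 + a\<^sup>2 + \<beta> * a)"
    unfolding \<eta>1 \<beta>[symmetric] by algebra
  finally have LT: "L (T * T) = 0"
    using two by simp
  have degT: "degree T \<le> k + 1"
    unfolding T_def by (intro degree_add_le) (auto intro: order.trans[OF degree_monom_le])
  define u where "u f = (\<Sum>i<k - 1. monom (f i) i)" for f :: "nat \<Rightarrow> 'a"
  have low: "L (u f * p) = 0" if "degree p \<le> k + 1" for f p
  \<comment> \<open>For \<open>k = 1\<close> the sum \<open>u f\<close> is empty, and the bound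
    \<open>k - 2\<close> would be distorted by truncated subtraction.\<close>
  proof (cases "k = 1")
    case False
    have "degree (u f) \<le> k - 2"
      unfolding u_def using False k
      by (intro degree_sum_le) (auto intro: order.trans[OF degree_monom_le])
    then have "degree (u f * p) < 2 * k"
      using degree_mult_le[of "u f" p] that k False by linarith
    then show ?thesis
      using L_coeff by (simp add: coeff_eq_0)
  qed (simp add: u_def L_def)
  have split: "two_twist k \<eta>1 \<eta>2 f = u f + smult (f (k - 1)) T" for f
    using two_twist_split[of k \<eta>1 \<eta>2 f] k unfolding u_def T_def by simp
  have "T * two_twist k \<eta>1 \<eta>2 f' = u f' * T + smult (f' (k - 1)) (T * T)"
    by (simp add: split distrib_left mult.commute)
  then have "two_twist k \<eta>1 \<eta>2 f * two_twist k \<eta>1 \<eta>2 f' =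
      u f * two_twist k \<eta>1 \<eta>2 f' + smult (f (k - 1)) (u f' * T) + smult (f (k - 1) * f' (k - 1)) (T * T)"
    unfolding split[of f] by (simp add: distrib_right smult_add_right)
  then have "L (two_twist k \<eta>1 \<eta>2 f * two_twist k \<eta>1 \<eta>2 f') = 0"
    by (simp only: L_add L_smult LT low[OF degT] low[OF degree_two_twist_le]) simp
  then show ?thesis
    by (simp add: L_def)
qed

section \<open>The twisted code on the roots of \<open>g\<close>\<close>

theorem proposition18:
  fixes s h t q k :: nat
    and K :: "'a::{field,finite} set"
    and a b c \<eta>1 \<eta>2 :: 'a
    and g :: "'a poly"
    and \<alpha> v :: "'a ^ 'n"
    and S1 :: "'a poly set"
    and C1 :: "('a ^ 'n) set"
  assumes "s \<ge> 2" and "h > 0" and "t > 0" and "t dvd h" and "s < h"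
    and "q = 2 ^ h" and "CARD('a) = q"
    and "is_subfield K" and "card K = 2 ^ t"
    and "a \<in> K" and "b \<in> K" and "c \<in> K" and "b \<noteq> 0" and "c \<noteq> 0"
    and "g = monom 1 (2 ^ s + 1) + monom a (2 ^ s) + monom b (2 ^ s - 1) + [:c:]"
    and "UNIV_splitting_field K g"
    and "CARD('n) = 2 ^ s + 1"
    and "range (\<lambda>i. \<alpha> $ i) = {x. poly g x = 0}" and "inj (\<lambda>i. \<alpha> $ i)"
    and "\<eta>2 \<noteq> 0" and "\<eta>1 = \<eta>2 * (b ^ (2 ^ (h - 1)) + a)"
    and "k = 2 ^ (s - 1)"
    and "\<And>(I :: 'n set) (d :: nat \<Rightarrow> 'a). card I = k \<Longrightarrow>
           (\<Prod>i\<in>I. [:- (\<alpha> $ i), 1:]) = (\<Sum>j\<le>k. monom (d j) (k - j)) \<Longrightarrow>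
           \<eta>1 * d 1 + \<eta>2 * (d 2 - (d 1)\<^sup>2) \<noteq> 1"
    and "v = (\<chi> i. inverse ((\<alpha> $ i) ^ (2 ^ (s - 1)) +
                             b ^ (2 ^ (h - 1)) * (\<alpha> $ i) ^ (2 ^ (s - 1) - 1)))"
    and "S1 = {(\<Sum>i=0..2 ^ (s - 1) - 1. monom (f i) i) +
               smult (f (2 ^ (s - 1) - 1))
                 (monom \<eta>1 (2 ^ (s - 1)) + monom \<eta>2 (2 ^ (s - 1) + 1)) | f. True}"
    and "C1 = ev \<alpha> v ` S1"
  shows "is_code (2 ^ s + 1) (2 ^ (s - 1)) (2 ^ (s - 1) + 2) q C1 \<and>
         self_orthogonal C1 \<and> is_MDS C1 \<and> is_TGRS_code \<alpha> v (2 ^ (s - 1)) C1"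
proof -
  have k: "k \<ge> 2" "2 ^ s = 2 * k"
  proof -
    obtain r where "s = Suc (Suc r)"
      using \<open>s \<ge> 2\<close> by (metis add_2_eq_Suc le_Suc_ex)
    then show "k \<ge> 2" "2 ^ s = 2 * k"
      using \<open>k = 2 ^ (s - 1)\<close> by simp_all
  qed
  have card_n: "CARD('n) = 2 * k + 1"
    using assms k by simp
  have card_a: "CARD('a) = 2 ^ h"
    using assms by simp
  have two: "(2 :: 'a) = 0"
    using two_eq_0_if_even_card[where 'a = 'a] card_a \<open>h > 0\<close> by simp
  \<comment> \<open>This is the square root of \<open>b\<close>: its square is b^q, which equals
    \<open>b\<close> in a field of q elements.\<close>
  define \<beta> where "\<beta> = b ^ (2 ^ (h - 1))"
  have \<beta>: "\<beta>\<^sup>2 = b"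
  proof -
    have "\<beta>\<^sup>2 = b ^ (2 ^ h)"
      using \<open>h > 0\<close> by (cases h) (simp_all add: \<beta>_def power_mult[symmetric] mult.commute)
    then show ?thesis
      using finite_field_power_card[of b] card_a by simp
  qed
  define A where "A = range (\<lambda>i. \<alpha> $ i)"
  have A: "finite A" "card A = 2 * k + 1"
    using card_image[OF \<open>inj (\<lambda>i. \<alpha> $ i)\<close>] card_n by (simp_all add: A_def)
  define G where "G = (\<Prod>x\<in>A. [:- x, 1:])"
  have g: "g = monom 1 (2 * k + 1) + monom a (2 * k) + monom b (2 * k - 1) + [:c:]"
    using assms k by simp
  \<comment> \<open>Both polynomials are monic of degree 2k + 1 and agree at the 2k + 1 points of
    \<open>A\<close>.\<close>
  have gG: "G = g"
  proof (rule poly_eqI_degree_lead_coeff)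
    show "coeff G (2 * k + 1) = coeff g (2 * k + 1)"
      using coeff_prod_linear_card[of "\<lambda>x. x" A] A k by (simp add: G_def g)
    show "degree G \<le> 2 * k + 1"
      using degree_prod_linear[of "\<lambda>x. x" A] A by (simp add: G_def)
    show "degree g \<le> 2 * k + 1"
      unfolding g by (intro degree_add_le) (auto intro: order.trans[OF degree_monom_le])
    show "2 * k + 1 \<le> card A"
      using A by simp
    fix z assume z: "z \<in> A"
    then have "poly G z = 0"
      using A by (auto simp: G_def poly_prod)
    then show "poly G z = poly g z"
      using z \<open>range (\<lambda>i. \<alpha> $ i) = {x. poly g x = 0}\<close> by (auto simp: A_def)
  qed
  have deriv: "poly (pderiv G) x = (x ^ k + \<beta> * x ^ (k - 1))\<^sup>2" for x
  proof -
    obtain m where m: "k = Suc m"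
      using k by (cases k) auto
    have "(y + z)\<^sup>2 = y\<^sup>2 + z\<^sup>2" for y z :: 'a
      using two by (simp add: power2_sum)
    then show ?thesis
      unfolding gG g using pderiv_char_2[OF two, of k a b c] k \<beta>
      by (simp add: poly_monom m power_mult_distrib power_mult[symmetric] mult.commute)
        (simp add: power2_eq_square)
  qed
  \<comment> \<open>Distinctness of the roots makes the derivative nonzero there, so the inverses
    defining \<open>v\<close> are genuine and not the default \<open>inverse 0 = 0\<close>.\<close>
  have deriv_nz: "poly (pderiv G) x \<noteq> 0" if "x \<in> A" for x
    using A by (auto simp: G_def poly_pderiv_prod_linear[OF A(1) that] poly_prod)
  have v_sq: "(v $ i)\<^sup>2 = 1 / poly (pderiv G) (\<alpha> $ i)" for i
    using \<open>v = _\<close> \<open>k = 2 ^ (s - 1)\<close> by (simp add: deriv \<beta>_def power_inverse divide_inverse)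
  have v: "v $ i \<noteq> 0" for i
    using v_sq[of i] deriv_nz[of "\<alpha> $ i"] by (auto simp: A_def)
  have C1: "C1 = ev \<alpha> v ` range (two_twist k \<eta>1 \<eta>2)"
  proof -
    have "{0..k - 1} = {..<k}"
      using k by auto
    then have "S1 = range (two_twist k \<eta>1 \<eta>2)"
      using \<open>S1 = _\<close> \<open>k = 2 ^ (s - 1)\<close> by (auto simp: two_twist_def)
    then show ?thesis
      using \<open>C1 = _\<close> by simp
  qed
  have params: "vec.subspace C1" "vec.dim C1 = k" "min_distance C1 = CARD('n) - k + 1"
    unfolding C1 using two_twist_code_parameters[of k \<alpha> \<eta>2 v \<eta>1] k card_n v
      \<open>inj (\<lambda>i. \<alpha> $ i)\<close> \<open>\<eta>2 \<noteq> 0\<close> assms(23) by auto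
  have "self_orthogonal C1"
  proof -
    have "(\<Sum>i\<in>UNIV. ev \<alpha> v (two_twist k \<eta>1 \<eta>2 f) $ i * ev \<alpha> v (two_twist k \<eta>1 \<eta>2 f') $ i) = 0" for f f'
    proof -
      \<comment> \<open>The two factors \<open>v $ i\<close> combine into 1/g' at the root, turning
        the inner product into the interpolation sum.\<close>
      have "ev \<alpha> v p $ i * ev \<alpha> v p' $ i = poly (p * p') (\<alpha> $ i) / poly (pderiv G) (\<alpha> $ i)" for p p' i
        using v_sq[of i] by (simp add: ev_def power2_eq_square divide_inverse mult_ac flip: v_sq)
      then have "(\<Sum>i\<in>UNIV. ev \<alpha> v (two_twist k \<eta>1 \<eta>2 f) $ i * ev \<alpha> v (two_twist k \<eta>1 \<eta>2 f') $ i)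
          = (\<Sum>x\<in>A. poly (two_twist k \<eta>1 \<eta>2 f * two_twist k \<eta>1 \<eta>2 f') x / poly (pderiv G) x)"
        unfolding A_def by (simp add: sum.reindex[OF \<open>inj (\<lambda>i. \<alpha> $ i)\<close>])
      also have "\<dots> = 0"
        unfolding G_def
        by (rule two_twist_orthogonal[where a = a and b = b and c = c and \<beta> = \<beta>])
          (use two k \<beta> A gG g G_def \<open>\<eta>1 = _\<close> \<beta>_def in auto)
      finally show ?thesis .
    qed
    then show ?thesis
      by (auto simp: self_orthogonal_def dual_code_def C1)
  qed
  moreover have "is_TGRS_code \<alpha> v k C1"
    unfolding is_TGRS_code_def C1
    using range_two_twist_eq_twisted_polys[of k "CARD('n)" \<eta>1 \<eta>2] card_n k v \<open>inj (\<lambda>i. \<alpha> $ i)\<close>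
    by auto
  ultimately show ?thesis
    using params card_n k card_a \<open>q = 2 ^ h\<close> \<open>k = 2 ^ (s - 1)\<close>
    by (auto simp: is_code_def is_MDS_def)
qed

end
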